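(* Let $(C,T)=(C,T_1,T_2,\ldots)$ be a sequence of non-negative random variables, $N=\sum_{i\ge1}\mathbf{1}_{\{T_i>0\}}$ and $m(\theta)=\mathbb{E}\sum_{i=1}^NT_i^{\theta}\in[0,\infty]$ for $\theta\in\mathbb{R}$. Suppose that $\mathbb{P}(T_i\in\{0,1\}\text{ for all }i\ge1)<1$ and $\mathbb{E}N>1$. Then each of the following two conditions is sufficient for $W^*<\infty$ almost surely and, therefore, for $\mathfrak{F}_{\Sigma}(C,T)\neq\emptyset$: (i) $m(\beta)<1$ and $\mathbb{E}C^{\beta}<\infty$ for some $0<\beta\le1$. (ii) $m(\alpha)=1$ for some $\alpha\in(0,1/5)$, $\mathbb{E}C<\infty$, there is some $\varepsilon>0$ such that $1<m(\theta)<\infty$ for all $\theta\in[-\varepsilon,\alpha+\varepsilon]$ with $\theta\neq\alpha$, and $\mathbb{E}N^{1+\delta}<\infty$ for some $\delta>0$.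
   Context: Convention (made without loss of generality throughout): the $T_i$ are arranged such that $N=\sum_{i\ge1}\mathbf{1}_{\{T_i>0\}}=\sup\{i\ge1:T_i>0\}$ (with $\sup\emptyset=0$); in $m(\theta)$ only indices with $T_i>0$ contribute, so $m(0)=\mathbb{E}N$. Fixed points: $\mathfrak{F}_{\Sigma}(C,T)$ is the set of probability distributions $P$ on $[0,\infty)$ such that, if $X,X_1,X_2,\ldots$ are i.i.d. with distribution $P$ and $(X_i)_{i\ge1}$ is independent of $(C,T)$, then $X\stackrel{d}{=}C+\sum_{i\ge1}T_iX_i$. Weighted branching model: $\mathbb{V}=\bigcup_{n\ge0}\mathbb{N}^n$ with $\mathbb{N}=\{1,2,\ldots\}$ and $\mathbb{N}^0=\{\varnothing\}$; $vi$ denotes $v$ with the entry $i$ appended. Let $(C(v),T(v))_{v\in\mathbb{V}}$, with $T(v)=(T_1(v),T_2(v),\ldots)$, be a family of i.i.d. copies of $(C,T)$ with $(C(\varnothing),T(\varnothing))=(C,T)$. Put $L(\varnothing)=1$, $L(vi)=L(v)T_i(v)$ for $v\in\mathbb{V}$, $i\in\mathbb{N}$, and $W^*=\sum_{v\in\mathbb{V}}L(v)C(v)\in[0,\infty]$. *)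

theory Defs
  imports "HOL-Probability.Probability"
begin

text \<open>
  The sequence \<open>T\<^sub>1, T\<^sub>2, \<dots>\<close> is indexed from \<open>0\<close>: \<open>T i\<close> is the paper's \<open>T\<^sub>i\<^sub>+\<^sub>1\<close>. Likewise a vertex
  of the tree is a \<^typ>\<open>nat list\<close>, the entry \<open>i\<close> standing for the paper's \<open>i + 1\<close>.
\<close>

definition offspring :: "(nat \<Rightarrow> 'w \<Rightarrow> real) \<Rightarrow> 'w \<Rightarrow> ennreal" where
  "offspring T \<omega> = (\<Sum>i. if T i \<omega> > 0 then 1 else 0)"

text \<open>
  The sum runs over the indices with \<open>T\<^sub>i > 0\<close>, wherever they are located in the sequence. If the
  positive entries come first, as one may assume without loss of generality, it is the sum over
  \<open>1 \<le> i \<le> N\<close>. In particular the value at \<open>\<theta> = 0\<close> is the expectation of \<open>N\<close>.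
\<close>

definition m_fun :: "'w measure \<Rightarrow> (nat \<Rightarrow> 'w \<Rightarrow> real) \<Rightarrow> real \<Rightarrow> ennreal" where
  "m_fun M T \<theta> =
    (\<integral>\<^sup>+\<omega>. (\<Sum>i. if T i \<omega> > 0 then ennreal (T i \<omega> powr \<theta>) else 0) \<partial>M)"

text \<open>Real powers on \<open>[0,\<infinity>]\<close>; used only for exponents \<open>p > 0\<close>.\<close>

definition ennpowr :: "ennreal \<Rightarrow> real \<Rightarrow> ennreal" where
  "ennpowr x p = (if x = \<infinity> then \<infinity> else ennreal (enn2real x powr p))"

text \<open>
  Solutions of \<open>X =\<^sub>d C + \<Sum>\<^sub>i T\<^sub>i X\<^sub>i\<close>. The independence of \<open>X\<^sub>1, X\<^sub>2, \<dots>\<close> among themselves and of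
  \<open>(C,T)\<close> is realised on a product space; the right-hand side is an a priori possibly infinite
  random variable, so the two laws are compared on \<open>[0,\<infinity>]\<close>.
\<close>

definition fixed_points ::
  "'w measure \<Rightarrow> ('w \<Rightarrow> real) \<Rightarrow> (nat \<Rightarrow> 'w \<Rightarrow> real) \<Rightarrow> real measure set" where
  "fixed_points M C T =
    {P. prob_space P \<and> sets P = sets borel \<and> (AE x in P. 0 \<le> x) \<and>
        distr P borel ennreal =
        distr (M \<Otimes>\<^sub>M PiM (UNIV :: nat set) (\<lambda>_. P)) borel
          (\<lambda>(\<omega>, x). ennreal (C \<omega>) + (\<Sum>i. ennreal (T i \<omega> * x i)))}"

text \<open>The families below give the copy \<open>(C(v), T(v))\<close> as \<open>(Cv v, Tv v)\<close>, with \<open>T\<^sub>i(v)\<close> as \<open>Tv v i\<close>.\<close>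

definition weighted_branching ::
  "'w measure \<Rightarrow> ('w \<Rightarrow> real) \<Rightarrow> (nat \<Rightarrow> 'w \<Rightarrow> real) \<Rightarrow>
    (nat list \<Rightarrow> 'w \<Rightarrow> real) \<Rightarrow> (nat list \<Rightarrow> nat \<Rightarrow> 'w \<Rightarrow> real) \<Rightarrow> bool" where
  "weighted_branching M C T Cv Tv \<longleftrightarrow>
    Cv [] = C \<and> Tv [] = T \<and>
    prob_space.indep_vars M (\<lambda>_. borel \<Otimes>\<^sub>M PiM UNIV (\<lambda>_. borel))
      (\<lambda>v \<omega>. (Cv v \<omega>, \<lambda>i. Tv v i \<omega>)) UNIV \<and>
    (\<forall>v. distr M (borel \<Otimes>\<^sub>M PiM UNIV (\<lambda>_. borel)) (\<lambda>\<omega>. (Cv v \<omega>, \<lambda>i. Tv v i \<omega>)) =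
         distr M (borel \<Otimes>\<^sub>M PiM UNIV (\<lambda>_. borel)) (\<lambda>\<omega>. (C \<omega>, \<lambda>i. T i \<omega>)))"

function branch_weight :: "(nat list \<Rightarrow> nat \<Rightarrow> 'w \<Rightarrow> real) \<Rightarrow> nat list \<Rightarrow> 'w \<Rightarrow> real" where
  "branch_weight Tv [] \<omega> = 1"
| "branch_weight Tv (v @ [i]) \<omega> = branch_weight Tv v \<omega> * Tv v i \<omega>"
  by (auto, metis rev_exhaust)
termination
  by (relation "Wellfounded.measure (\<lambda>(Tv, v, \<omega>). length v)") auto

definition W_star ::
  "(nat list \<Rightarrow> 'w \<Rightarrow> real) \<Rightarrow> (nat list \<Rightarrow> nat \<Rightarrow> 'w \<Rightarrow> real) \<Rightarrow> 'w \<Rightarrow> ennreal" where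
  "W_star Cv Tv \<omega> = (\<Sum>\<^sub>\<infinity>v\<in>UNIV. ennreal (branch_weight Tv v \<omega> * Cv v \<omega>))"

end

theory Submission
  imports Defs
begin

text \<open>
  Let \<open>W\<^sub>K\<close> be the part of \<open>W\<^sup>*\<close> over those vertices all of whose ancestors have weight at most \<open>K\<close>.
  Under (ii), \<open>\<Sum> L(v)\<^sup>\<alpha>\<close> over a generation has constant mean, so with probability at least \<open>1 - K\<^sup>-\<^sup>\<alpha>\<close> no
  weight ever exceeds \<open>K\<close> and \<open>W\<^sup>* = W\<^sub>K\<close>. For \<open>\<theta>\<close> slightly above \<open>\<alpha>\<close> and \<open>A\<close> large, the function
  \<open>g(l) = max 0 (A l\<^sup>\<alpha> - l\<^sup>\<theta>)\<close> satisfies \<open>E \<Sum>\<^sub>i g(l T\<^sub>i) + \<delta> l\<^sup>\<theta> \<le> g(l)\<close> for \<open>l \<le> K\<close>, because \<open>m(\<alpha>) = 1 < m(\<theta>)\<close>.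
  Telescoping over the generations bounds the mean of \<open>\<Sum> L(v)\<^sup>\<theta>\<close> over the killed tree, hence that of
  \<open>W\<^sub>K\<close>, as \<open>L(v) \<le> K\<^sup>1\<^sup>-\<^sup>\<theta> L(v)\<^sup>\<theta>\<close> there. Under (i), \<open>E (W\<^sup>*)\<^sup>\<beta> \<le> E C\<^sup>\<beta> / (1 - m(\<beta>))\<close>. The law of
  \<open>W\<^sup>*\<close> is a fixed point by the recursion \<open>W\<^sup>* = C + \<Sum>\<^sub>i T\<^sub>i W\<^sup>*(i)\<close> over the subtrees of the root.
\<close>

subsection \<open>Countable sums and products of laws\<close>

text \<open>Turns the unordered sum in \<open>W_star\<close> into an integral, to which monotone
  convergence and Tonelli apply.\<close>

lemma infsum_ennreal_eq_nn_integral_count_space: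
  fixes f :: "'a \<Rightarrow> ennreal"
  shows "infsum f A = (\<integral>\<^sup>+x. f x \<partial>count_space A)"
proof -
  have "infsum f A = (SUP F\<in>{F. finite F \<and> F \<subseteq> A}. sum f F)"
    by (rule nonneg_infsum_complete) simp
  also have "\<dots> = (\<integral>\<^sup>+x. f x \<partial>count_space A)"
  proof (rule antisym)
    show "(SUP F\<in>{F. finite F \<and> F \<subseteq> A}. sum f F) \<le> (\<integral>\<^sup>+x. f x \<partial>count_space A)"
    proof (rule SUP_least, safe)
      fix F assume F: "finite F" "F \<subseteq> A"
      have "sum f F = (\<integral>\<^sup>+x. f x * indicator F x \<partial>count_space A)"
        using F by (subst nn_integral_count_space'[of F]) auto
      also have "\<dots> \<le> (\<integral>\<^sup>+x. f x \<partial>count_space A)"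
        by (intro nn_integral_mono) (auto split: split_indicator)
      finally show "sum f F \<le> (\<integral>\<^sup>+x. f x \<partial>count_space A)" .
    qed
    show "(\<integral>\<^sup>+x. f x \<partial>count_space A) \<le> (SUP F\<in>{F. finite F \<and> F \<subseteq> A}. sum f F)"
      unfolding nn_integral_def
    proof (rule SUP_least, safe)
      fix g assume g: "simple_function (count_space A) g" "g \<le> f"
      have fin: "finite (g ` A)" using g by simp
      show "integral\<^sup>S (count_space A) g \<le> (SUP F\<in>{F. finite F \<and> F \<subseteq> A}. sum f F)"
      proof (cases "finite {a\<in>A. 0 < g a}")
        case True
        have "integral\<^sup>S (count_space A) g = (\<integral>\<^sup>+x. g x \<partial>count_space A)"
          using g by (simp add: nn_integral_eq_simple_integral)
        also have "\<dots> = (\<Sum>a|a\<in>A \<and> 0 < g a. g a)"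
          using True by (rule nn_integral_count_space)
        also have "\<dots> \<le> (\<Sum>a|a\<in>A \<and> 0 < g a. f a)"
          using g by (intro sum_mono) (auto simp: le_fun_def)
        also have "\<dots> \<le> (SUP F\<in>{F. finite F \<and> F \<subseteq> A}. sum f F)"
          using True by (intro SUP_upper) auto
        finally show ?thesis .
      next
        case False
        \<comment> \<open>The simple function \<open>g\<close> has finitely many values, so
          infinitely many points with \<open>0 < g a\<close> share one value \<open>c\<close>. As
          \<open>f\<close> is at least \<open>c\<close> there, its finite sums are
          unbounded.\<close>
        define Y where "Y = g ` {a\<in>A. 0 < g a}"
        have "finite Y" unfolding Y_def by (rule finite_subset[OF _ fin]) auto
        have "\<exists>c\<in>Y. infinite {a\<in>{a\<in>A. 0 < g a}. g a = c}"
          using pigeonhole_infinite[of "{a\<in>A. 0 < g a}" g] False \<open>finite Y\<close> unfolding Y_def by auto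
        then obtain c where cY: "c \<in> Y" and inf': "infinite {a\<in>{a\<in>A. 0 < g a}. g a = c}"
          by blast
        have c: "c > 0" using cY by (auto simp: Y_def)
        have inf: "infinite {a\<in>A. g a = c}"
          by (rule infinite_super[OF _ inf']) auto
        have "infsum f {a\<in>A. g a = c} = \<infinity>"
          using inf c g by (intro infsum_superconst_infinite_ennreal[where b=c]) (auto simp: le_fun_def)
        moreover have "infsum f {a\<in>A. g a = c} = (SUP F\<in>{F. finite F \<and> F \<subseteq> {a\<in>A. g a = c}}. sum f F)"
          by (rule nonneg_infsum_complete) simp
        moreover have "\<dots> \<le> (SUP F\<in>{F. finite F \<and> F \<subseteq> A}. sum f F)"
          by (rule SUP_subset_mono) auto
        ultimately have "(SUP F\<in>{F. finite F \<and> F \<subseteq> A}. sum f F) = top"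
          by (metis infinity_ennreal_def top_unique)
        then show ?thesis by (metis top_greatest)
      qed
    qed
  qed
  finally show ?thesis .
qed

text \<open>Applied with \<open>length\<close>, \<open>last\<close> and \<open>hd\<close>, to sort
  vertices by generation, by last edge and by first edge.\<close>

lemma nn_integral_count_space_fibres:
  fixes f :: "'a \<Rightarrow> ennreal" and g :: "'a \<Rightarrow> nat"
  shows "(\<integral>\<^sup>+x. f x \<partial>count_space A) = (\<Sum>n. \<integral>\<^sup>+x. f x \<partial>count_space {x\<in>A. g x = n})"
proof -
  have "(\<Sum>n. \<integral>\<^sup>+x. f x \<partial>count_space {x\<in>A. g x = n}) =
      (\<Sum>n. \<integral>\<^sup>+x. f x * indicator {x\<in>A. g x = n} x \<partial>count_space A)"
  proof (rule suminf_cong)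
    fix n
    have "(\<integral>\<^sup>+x. f x \<partial>count_space {x\<in>A. g x = n}) =
        (\<integral>\<^sup>+x. f x * indicator {x\<in>A. g x = n} x \<partial>count_space {x\<in>A. g x = n})"
      by (rule nn_integral_cong) simp
    also have "\<dots> = (\<integral>\<^sup>+x. f x * indicator {x\<in>A. g x = n} x \<partial>count_space A)"
      by (rule nn_integral_count_space_eq) auto
    finally show "(\<integral>\<^sup>+x. f x \<partial>count_space {x\<in>A. g x = n}) =
        (\<integral>\<^sup>+x. f x * indicator {x\<in>A. g x = n} x \<partial>count_space A)" .
  qed
  also have "\<dots> = (\<integral>\<^sup>+x. (\<Sum>n. f x * indicator {x\<in>A. g x = n} x) \<partial>count_space A)"
    by (rule nn_integral_suminf[symmetric]) auto
  also have "\<dots> = (\<integral>\<^sup>+x. f x \<partial>count_space A)"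
  proof (rule nn_integral_cong)
    fix x assume x: "x \<in> space (count_space A)"
    have "(\<Sum>n. f x * indicator {x\<in>A. g x = n} x) = (\<Sum>n\<in>{g x}. f x * indicator {x\<in>A. g x = n} x)"
      by (rule suminf_finite) auto
    also have "\<dots> = f x"
      using x by simp
    finally show "(\<Sum>n. f x * indicator {x\<in>A. g x = n} x) = f x" .
  qed
  finally show ?thesis ..
qed

lemma nn_integral_lists_snoc:
  fixes f :: "nat list \<Rightarrow> ennreal"
  shows "(\<integral>\<^sup>+w. f w \<partial>count_space {w. length w = Suc n}) =
    (\<integral>\<^sup>+v. (\<Sum>i. f (v @ [i])) \<partial>count_space {v. length v = n})"
proof -
  have "(\<integral>\<^sup>+w. f w \<partial>count_space {w. length w = Suc n}) =
      (\<Sum>i. \<integral>\<^sup>+w. f w \<partial>count_space {w \<in> {w. length w = Suc n}. last w = i})"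
    by (rule nn_integral_count_space_fibres)
  also have "\<dots> = (\<Sum>i. \<integral>\<^sup>+v. f (v @ [i]) \<partial>count_space {v. length v = n})"
  proof (intro suminf_cong nn_integral_bij_count_space[symmetric])
    fix i
    show "bij_betw (\<lambda>v. v @ [i]) {v. length v = n} {w \<in> {w. length w = Suc n}. last w = i}"
      by (rule bij_betwI[where g=butlast]) (auto simp: append_butlast_last_id length_Suc_conv_rev)
  qed
  also have "\<dots> = (\<integral>\<^sup>+v. (\<Sum>i. f (v @ [i])) \<partial>count_space {v. length v = n})"
    by (rule nn_integral_suminf[symmetric]) auto
  finally show ?thesis .
qed

lemma nn_integral_lists_Cons:
  fixes f :: "nat list \<Rightarrow> ennreal"
  shows "(\<integral>\<^sup>+v. f v \<partial>count_space UNIV) =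
    f [] + (\<Sum>i. \<integral>\<^sup>+v. f (i # v) \<partial>count_space UNIV)"
proof -
  have "(\<integral>\<^sup>+v. f v \<partial>count_space UNIV) =
      (\<integral>\<^sup>+v. f v * indicator {[]} v + f v * indicator {v. v \<noteq> []} v \<partial>count_space UNIV)"
    by (intro nn_integral_cong) (auto split: split_indicator)
  also have "\<dots> = f [] + (\<integral>\<^sup>+v. f v \<partial>count_space {v. v \<noteq> []})"
    by (simp add: nn_integral_add nn_integral_count_space_indicator[of "{v. v \<noteq> []}"])
  also have "(\<integral>\<^sup>+v. f v \<partial>count_space {v. v \<noteq> []}) =
      (\<Sum>i. \<integral>\<^sup>+w. f w \<partial>count_space {w \<in> {v. v \<noteq> []}. hd w = i})"
    by (rule nn_integral_count_space_fibres)
  also have "\<dots> = (\<Sum>i. \<integral>\<^sup>+v. f (i # v) \<partial>count_space UNIV)"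
  proof (intro suminf_cong nn_integral_bij_count_space[symmetric])
    fix i
    show "bij_betw (\<lambda>v. i # v) UNIV {w \<in> {v. v \<noteq> []}. hd w = i}"
      by (rule bij_betwI[where g=tl]) auto
  qed
  finally show ?thesis .
qed

text \<open>The finite sum \<open>s\<close> bounds every
  \<open>\<bar>a v\<bar> powr \<beta>\<close>, so the \<open>\<bar>a v\<bar>\<close> are bounded
  too. The factor \<open>\<bar>a v\<bar> powr (1 - \<beta>)\<close> is then at most the constant
  \<open>b\<close>.\<close>

lemma sum_abs_finite_if_sum_powr_finite:
  fixes a :: "'a \<Rightarrow> real"
  assumes \<beta>: "0 < \<beta>" "\<beta> \<le> 1"
    and fin: "(\<integral>\<^sup>+v. ennreal (\<bar>a v\<bar> powr \<beta>) \<partial>count_space A) < \<infinity>"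
  shows "(\<integral>\<^sup>+v. ennreal \<bar>a v\<bar> \<partial>count_space A) < \<infinity>"
proof -
  define s where "s = enn2real (\<integral>\<^sup>+v. ennreal (\<bar>a v\<bar> powr \<beta>) \<partial>count_space A)"
  have s: "(\<integral>\<^sup>+v. ennreal (\<bar>a v\<bar> powr \<beta>) \<partial>count_space A) = ennreal s" and s0: "s \<ge> 0"
    using fin by (auto simp: s_def less_top)
  define b where "b = (s powr (1 / \<beta>)) powr (1 - \<beta>)"
  have "\<bar>a v\<bar> \<le> b * \<bar>a v\<bar> powr \<beta>" if "v \<in> A" for v
  proof -
    have "ennreal (\<bar>a v\<bar> powr \<beta>) \<le> ennreal s"
      unfolding s[symmetric] using that by (rule nn_integral_ge_point)
    then have "\<bar>a v\<bar> powr \<beta> \<le> s" using s0 by simp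
    then have "(\<bar>a v\<bar> powr \<beta>) powr (1 / \<beta>) \<le> s powr (1 / \<beta>)"
      using \<beta> by (intro powr_mono2) auto
    then have "\<bar>a v\<bar> \<le> s powr (1 / \<beta>)" using \<beta> by (simp add: powr_powr)
    then have "\<bar>a v\<bar> powr (1 - \<beta>) \<le> b"
      unfolding b_def using \<beta> by (intro powr_mono2) auto
    then have "\<bar>a v\<bar> powr (1 - \<beta>) * \<bar>a v\<bar> powr \<beta> \<le> b * \<bar>a v\<bar> powr \<beta>"
      by (intro mult_right_mono) auto
    then show ?thesis by (simp add: powr_add[symmetric])
  qed
  then have "(\<integral>\<^sup>+v. ennreal \<bar>a v\<bar> \<partial>count_space A) \<le>
      (\<integral>\<^sup>+v. ennreal b * ennreal (\<bar>a v\<bar> powr \<beta>) \<partial>count_space A)"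
    by (intro nn_integral_mono) (auto simp: ennreal_mult''[symmetric] intro!: ennreal_leI)
  also have "\<dots> = ennreal b * ennreal s" by (simp add: nn_integral_cmult s)
  also have "\<dots> < \<infinity>" by (simp add: ennreal_mult_less_top)
  finally show ?thesis .
qed

text \<open>By induction the first \<open>n\<close> terms of \<open>b\<close> together with
  \<open>a n\<close> stay below \<open>a 0\<close>. The additive form avoids subtraction of possibly
  infinite values.\<close>

lemma suminf_le_of_telescope:
  fixes a b :: "nat \<Rightarrow> ennreal"
  assumes "\<And>n. a (Suc n) + b n \<le> a n"
  shows "(\<Sum>n. b n) \<le> a 0"
proof -
  have "(\<Sum>k<n. b k) + a n \<le> a 0" for n
  proof (induction n)
    case (Suc n)
    have "(\<Sum>k<Suc n. b k) + a (Suc n) = (\<Sum>k<n. b k) + (a (Suc n) + b n)"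
      by (simp add: ac_simps)
    also have "\<dots> \<le> (\<Sum>k<n. b k) + a n"
      by (intro add_left_mono assms)
    finally show ?case using Suc by order
  qed simp
  then have "(\<Sum>k<n. b k) \<le> a 0" for n
    using order_trans[OF add_increasing2[OF zero_le order_refl]] by blast
  then show ?thesis
    unfolding suminf_eq_SUP by (intro SUP_least)
qed

text \<open>Independence of two blocks of nodes passes to functions of the blocks. It serves twice:
  for the weight of a vertex and its node, and for the root and the sequence of its subtree
  totals.\<close>

lemma (in prob_space) distr_Pair_of_indep_var:
  assumes indep: "indep_var S U T V"
    and f [measurable]: "f \<in> S \<rightarrow>\<^sub>M N" and g [measurable]: "g \<in> T \<rightarrow>\<^sub>M N'"
  shows "distr M N (\<lambda>\<omega>. f (U \<omega>)) \<Otimes>\<^sub>M distr M N' (\<lambda>\<omega>. g (V \<omega>)) =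
    distr M (N \<Otimes>\<^sub>M N') (\<lambda>\<omega>. (f (U \<omega>), g (V \<omega>)))"
proof -
  have [measurable]: "U \<in> M \<rightarrow>\<^sub>M S" "V \<in> M \<rightarrow>\<^sub>M T"
    and joint: "distr M S U \<Otimes>\<^sub>M distr M T V = distr M (S \<Otimes>\<^sub>M T) (\<lambda>\<omega>. (U \<omega>, V \<omega>))"
    using indep by (auto simp: indep_var_distribution_eq)
  have "prob_space (distr (distr M T V) N' g)"
    by (intro prob_space.prob_space_distr prob_space_distr) auto
  then have "sigma_finite_measure (distr (distr M T V) N' g)"
    by (intro finite_measure.axioms prob_space.axioms)
  then have "distr (distr M S U) N f \<Otimes>\<^sub>M distr (distr M T V) N' g =
      distr (distr M S U \<Otimes>\<^sub>M distr M T V) (N \<Otimes>\<^sub>M N') (\<lambda>(x, y). (f x, g y))"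
    by (intro pair_measure_distr) auto
  also have "\<dots> = distr M (N \<Otimes>\<^sub>M N') (\<lambda>\<omega>. (f (U \<omega>), g (V \<omega>)))"
    unfolding joint by (subst distr_distr) (auto simp: comp_def)
  finally show ?thesis
    by (simp add: distr_distr comp_def)
qed

text \<open>For countable \<open>I\<close>, measurability of each \<open>f i\<close> is joint
  measurability on the product with the counting measure, which is sigma-finite.\<close>

lemma borel_measurable_nn_integral_count_space:
  fixes f :: "'i \<Rightarrow> 'a \<Rightarrow> ennreal"
  assumes I: "countable I" and f: "\<And>i. i \<in> I \<Longrightarrow> f i \<in> borel_measurable M"
  shows "(\<lambda>x. \<integral>\<^sup>+i. f i x \<partial>count_space I) \<in> borel_measurable M"
proof -
  interpret sigma_finite_measure "count_space I"
    using I by (rule sigma_finite_measure_count_space_countable)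
  have "(\<lambda>q. f (snd q) (fst q)) \<in> borel_measurable (M \<Otimes>\<^sub>M count_space I)"
    using I by (rule measurable_compose_countable'[rotated 2]) (use f in auto)
  then show ?thesis
    by (intro borel_measurable_nn_integral) (simp add: case_prod_unfold)
qed

subsection \<open>Weights along a tree\<close>

text \<open>The function \<open>\<phi>\<close> is the identity for the weights \<open>L(v)\<close>, and \<open>kill K\<close> below to prune the tree.\<close>

function weight :: "(real \<Rightarrow> real) \<Rightarrow> nat list \<Rightarrow> (nat list \<Rightarrow> real \<times> (nat \<Rightarrow> real)) \<Rightarrow> real" where
  "weight \<phi> [] x = 1"
| "weight \<phi> (v @ [i]) x = \<phi> (weight \<phi> v x * snd (x v) i)"
  by (auto, metis rev_exhaust)
termination
  by (relation "Wellfounded.measure (\<lambda>(\<phi>, v, x). length v)") auto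

abbreviation node_space :: "(real \<times> (nat \<Rightarrow> real)) measure" where
  "node_space \<equiv> borel \<Otimes>\<^sub>M PiM UNIV (\<lambda>_. borel)"

text \<open>Only proper prefixes of \<open>v\<close> are read. The larger set of all shorter lists
  still omits \<open>v\<close>, which makes the weight of \<open>v\<close> independent of the node
  at \<open>v\<close>.\<close>

lemma weight_cong:
  assumes "\<And>u. length u < length v \<Longrightarrow> x u = y u"
  shows "weight \<phi> v x = weight \<phi> v y"
  using assms by (induction v rule: rev_induct) auto

lemma measurable_weight:
  assumes [measurable]: "\<phi> \<in> borel_measurable borel"
    and "{u. length u < length v} \<subseteq> A"
  shows "weight \<phi> v \<in> borel_measurable (PiM A (\<lambda>_. node_space))"
  using assms(2)
proof (induction v rule: rev_induct)
  case Nil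
  have "weight \<phi> [] = (\<lambda>x. 1)" by (rule ext) simp
  then show ?case by simp
next
  case (snoc i v)
  then have "v \<in> A" by auto
  then have [measurable]: "(\<lambda>x. x v) \<in> PiM A (\<lambda>_. node_space) \<rightarrow>\<^sub>M node_space"
    by (rule measurable_component_singleton)
  have [measurable]: "weight \<phi> v \<in> borel_measurable (PiM A (\<lambda>_. node_space))"
    using snoc by (auto simp: subset_eq)
  have "weight \<phi> (v @ [i]) = (\<lambda>x. \<phi> (weight \<phi> v x * snd (x v) i))" by (rule ext) simp
  then show ?case by simp
qed

text \<open>A weight above \<open>K\<close> becomes 0, and 0 is absorbing for the recursion of
  \<open>weight\<close>. Pruning thus leaves the index set of the tree unchanged.\<close>

definition kill :: "real \<Rightarrow> real \<Rightarrow> real" where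
  "kill K y = (if \<bar>y\<bar> \<le> K then y else 0)"

lemma measurable_kill [measurable]: "kill K \<in> borel_measurable borel"
  unfolding kill_def by measurable

lemma abs_weight_kill_le:
  assumes "1 \<le> K"
  shows "\<bar>weight (kill K) v x\<bar> \<le> K"
  using assms by (cases v rule: rev_cases) (auto simp: kill_def)

text \<open>Induction along the path: under the bound nothing is ever cut. The bound is on weights
  of the killed tree just before the cut, so its failure is an exceedance as counted in
  \<open>expected_exceedances\<close>.\<close>

lemma weight_kill_eq_weight:
  assumes "\<And>v i. \<bar>weight (kill K) v x * snd (x v) i\<bar> \<le> K"
  shows "weight (kill K) v x = weight (\<lambda>y. y) v x"
proof (induction v rule: rev_induct)
  case (snoc i v)
  with assms[of v i] show ?case by (simp add: kill_def)
qed simp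

text \<open>The recursion of \<open>weight\<close> splits off the last edge, whereas subtrees of the
  root split off the first. For the identity the weight is a product along the path, so both are
  possible.\<close>

lemma weight_Cons:
  "weight (\<lambda>y. y) (i # v) x = snd (x []) i * weight (\<lambda>y. y) v (\<lambda>u. x (i # u))"
proof (induction v rule: rev_induct)
  case Nil
  show ?case using weight.simps(2)[of "\<lambda>y. y" "[]" i x] by simp
next
  case (snoc j v)
  then show ?case using weight.simps(2)[of "\<lambda>y. y" "i # v" j x] by (simp add: ac_simps)
qed

lemma weight_nonneg:
  assumes "\<And>v i. 0 \<le> snd (x v) i"
  shows "0 \<le> weight (\<lambda>y. y) v x"
  using assms by (induction v rule: rev_induct) auto

text \<open>This is \<open>W_star\<close> as a function of the whole configuration \<open>x\<close>;
  the total of a subtree is the same function at \<open>\<lambda>u. x (i # u)\<close>.\<close>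

definition total_weight :: "(nat list \<Rightarrow> real \<times> (nat \<Rightarrow> real)) \<Rightarrow> ennreal" where
  "total_weight x = (\<integral>\<^sup>+v. ennreal (weight (\<lambda>y. y) v x * fst (x v)) \<partial>count_space UNIV)"

lemma measurable_total_weight [measurable]:
  "total_weight \<in> borel_measurable (PiM UNIV (\<lambda>_. node_space))"
proof -
  have [measurable]: "weight (\<lambda>y. y) v \<in> borel_measurable (PiM UNIV (\<lambda>_. node_space))" for v
    by (rule measurable_weight) auto
  show ?thesis
    unfolding total_weight_def[abs_def] by (rule borel_measurable_nn_integral_count_space) auto
qed

lemma total_weight_recursion:
  assumes "\<And>v. 0 \<le> fst (x v)" "\<And>v i. 0 \<le> snd (x v) i"
  shows "total_weight x =
    ennreal (fst (x [])) + (\<Sum>i. ennreal (snd (x []) i) * total_weight (\<lambda>u. x (i # u)))"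
proof -
  have "ennreal (weight (\<lambda>y. y) (i # v) x * fst (x (i # v))) = ennreal (snd (x []) i) *
      ennreal (weight (\<lambda>y. y) v (\<lambda>u. x (i # u)) * fst (x (i # v)))" for i v
    using assms weight_nonneg[of "\<lambda>u. x (i # u)" v]
    by (simp add: weight_Cons mult.assoc flip: ennreal_mult)
  then show ?thesis
    unfolding total_weight_def by (subst nn_integral_lists_Cons) (simp add: nn_integral_cmult)
qed

subsection \<open>Expected sums over generations\<close>

text \<open>Away from the root only the law of a node is known, so signs are controlled almost
  surely at best. The moments below therefore carry absolute values, and non-negativity enters in
  \<open>limit_law_fixed_point\<close>.\<close>

locale iid_tree = prob_space M
  for M :: "'w measure" +
  fixes X :: "nat list \<Rightarrow> 'w \<Rightarrow> real \<times> (nat \<Rightarrow> real)"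
    and D :: "(real \<times> (nat \<Rightarrow> real)) measure"
  assumes indep: "indep_vars (\<lambda>_. node_space) X UNIV"
    and law: "\<And>v. distr M node_space (X v) = D"
begin

lemma measurable_node [measurable]: "X v \<in> M \<rightarrow>\<^sub>M node_space"
  using indep by (simp add: indep_vars_def)

lemma sets_D [measurable_cong]: "sets D = sets node_space"
  unfolding law[of "[]", symmetric] by simp

lemma prob_space_D: "prob_space D"
  unfolding law[of "[]", symmetric] by (rule prob_space_distr) measurable

lemma measurable_tree: "(\<lambda>\<omega> v. X v \<omega>) \<in> M \<rightarrow>\<^sub>M PiM UNIV (\<lambda>_. node_space)"
  by (rule measurable_PiM_single') (auto dest: measurable_space[OF measurable_node])

lemma measurable_weight_tree [measurable]:
  assumes "\<phi> \<in> borel_measurable borel"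
  shows "(\<lambda>\<omega>. weight \<phi> v (\<lambda>u. X u \<omega>)) \<in> borel_measurable M"
  by (rule measurable_compose[OF measurable_tree measurable_weight]) (use assms in auto)

text \<open>The branching property: the weight of \<open>v\<close> is a function of the nodes on
  strictly shorter lists, hence independent of \<open>X v\<close>, and Tonelli applies to the
  product law.\<close>

lemma nn_integral_weight_node:
  assumes \<phi>: "\<phi> \<in> borel_measurable borel"
    and H: "H \<in> borel_measurable (borel \<Otimes>\<^sub>M node_space)"
  shows "(\<integral>\<^sup>+\<omega>. H (weight \<phi> v (\<lambda>u. X u \<omega>), X v \<omega>) \<partial>M) =
    (\<integral>\<^sup>+\<omega>. \<integral>\<^sup>+p. H (weight \<phi> v (\<lambda>u. X u \<omega>), p) \<partial>D \<partial>M)"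
proof -
  interpret D: prob_space D by (rule prob_space_D)
  define A where "A = {u::nat list. length u < length v}"
  define U where "U \<omega> = weight \<phi> v (\<lambda>u. X u \<omega>)" for \<omega>
  have U [measurable]: "U \<in> borel_measurable M"
    unfolding U_def using \<phi> by measurable
  have "indep_var (PiM A (\<lambda>_. node_space)) (\<lambda>\<omega>. restrict (\<lambda>u. X u \<omega>) A)
      (PiM {v} (\<lambda>_. node_space)) (\<lambda>\<omega>. restrict (\<lambda>u. X u \<omega>) {v})"
    by (rule indep_var_restrict[OF indep]) (auto simp: A_def)
  then have "distr M borel (\<lambda>\<omega>. weight \<phi> v (restrict (\<lambda>u. X u \<omega>) A)) \<Otimes>\<^sub>M
      distr M node_space (\<lambda>\<omega>. restrict (\<lambda>u. X u \<omega>) {v} v) =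
      distr M (borel \<Otimes>\<^sub>M node_space)
        (\<lambda>\<omega>. (weight \<phi> v (restrict (\<lambda>u. X u \<omega>) A), restrict (\<lambda>u. X u \<omega>) {v} v))"
    by (rule distr_Pair_of_indep_var)
       (auto simp: A_def intro!: measurable_weight[OF \<phi>] measurable_component_singleton)
  moreover have "weight \<phi> v (restrict (\<lambda>u. X u \<omega>) A) = U \<omega>" for \<omega>
    by (auto simp: U_def A_def intro!: weight_cong)
  ultimately have joint: "distr M borel U \<Otimes>\<^sub>M D = distr M (borel \<Otimes>\<^sub>M node_space) (\<lambda>\<omega>. (U \<omega>, X v \<omega>))"
    by (simp add: law)
  have H' [measurable]: "H \<in> borel_measurable (N \<Otimes>\<^sub>M D)" if "sets N = sets borel" for N
    using H measurable_cong_sets[OF sets_pair_measure_cong[OF that sets_D] refl] by blast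
  have "(\<integral>\<^sup>+\<omega>. H (U \<omega>, X v \<omega>) \<partial>M) = (\<integral>\<^sup>+q. H q \<partial>(distr M borel U \<Otimes>\<^sub>M D))"
    unfolding joint by (rule nn_integral_distr[symmetric]) (use H in auto)
  also have "\<dots> = (\<integral>\<^sup>+u. \<integral>\<^sup>+p. H (u, p) \<partial>D \<partial>distr M borel U)"
    by (rule D.nn_integral_fst[symmetric]) (rule H', simp)
  also have "\<dots> = (\<integral>\<^sup>+\<omega>. \<integral>\<^sup>+p. H (U \<omega>, p) \<partial>D \<partial>M)"
    using H'[OF refl] by (intro nn_integral_distr) measurable
  finally show ?thesis
    by (simp add: U_def)
qed

text \<open>The integral of \<open>f\<close> against the intensity measure of the point process of
  weights in generation \<open>n\<close>.\<close>

definition level :: "(real \<Rightarrow> real) \<Rightarrow> (real \<Rightarrow> ennreal) \<Rightarrow> nat \<Rightarrow> ennreal" where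
  "level \<phi> f n = (\<integral>\<^sup>+v. \<integral>\<^sup>+\<omega>. f (weight \<phi> v (\<lambda>u. X u \<omega>)) \<partial>M \<partial>count_space {v. length v = n})"

lemma level_0: "level \<phi> f 0 = f 1"
  by (simp add: level_def nn_integral_count_space_finite emeasure_space_1)

text \<open>The children of \<open>v\<close> read the node at \<open>v\<close>, which is independent
  of the weight of \<open>v\<close>. Averaging over that node applies the mean transition operator
  once to \<open>f\<close>.\<close>

lemma level_Suc:
  assumes [measurable]: "\<phi> \<in> borel_measurable borel" "f \<in> borel_measurable borel"
  shows "level \<phi> f (Suc n) = level \<phi> (\<lambda>l. \<integral>\<^sup>+p. (\<Sum>i. f (\<phi> (l * snd p i))) \<partial>D) n"
  unfolding level_def nn_integral_lists_snoc
proof (rule nn_integral_cong)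
  fix v
  have "(\<Sum>i. \<integral>\<^sup>+\<omega>. f (weight \<phi> (v @ [i]) (\<lambda>u. X u \<omega>)) \<partial>M) =
      (\<integral>\<^sup>+\<omega>. (\<Sum>i. f (weight \<phi> (v @ [i]) (\<lambda>u. X u \<omega>))) \<partial>M)"
    by (rule nn_integral_suminf[symmetric]) measurable
  also have "\<dots> = (\<integral>\<^sup>+\<omega>. \<integral>\<^sup>+p. (\<Sum>i. f (\<phi> (weight \<phi> v (\<lambda>u. X u \<omega>) * snd p i))) \<partial>D \<partial>M)"
    using nn_integral_weight_node[of \<phi> "\<lambda>(l, p). \<Sum>i. f (\<phi> (l * snd p i))" v] by simp
  finally show "(\<Sum>i. \<integral>\<^sup>+\<omega>. f (weight \<phi> (v @ [i]) (\<lambda>u. X u \<omega>)) \<partial>M) = \<dots>" .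
qed

text \<open>The comparison is asked only at values attained as weights, so in the killed tree it may
  use that they are bounded by \<open>K\<close>.\<close>

lemma level_mono:
  assumes "\<And>v x. f (weight \<phi> v x) \<le> g (weight \<phi> v x)"
  shows "level \<phi> f n \<le> level \<phi> g n"
  unfolding level_def by (intro nn_integral_mono assms)

lemma level_add:
  assumes [measurable]: "\<phi> \<in> borel_measurable borel"
    "f \<in> borel_measurable borel" "g \<in> borel_measurable borel"
  shows "level \<phi> (\<lambda>l. f l + g l) n = level \<phi> f n + level \<phi> g n"
  unfolding level_def by (simp add: nn_integral_add)

lemma level_cmult:
  assumes [measurable]: "\<phi> \<in> borel_measurable borel" "f \<in> borel_measurable borel"
  shows "level \<phi> (\<lambda>l. c * f l) n = c * level \<phi> f n"
  unfolding level_def by (simp add: nn_integral_cmult)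

lemma measurable_nn_integral_D [measurable]:
  assumes "(\<lambda>(l, p). H l p) \<in> borel_measurable (N \<Otimes>\<^sub>M D)"
  shows "(\<lambda>l. \<integral>\<^sup>+p. H l p \<partial>D) \<in> borel_measurable N"
proof -
  interpret D: prob_space D by (rule prob_space_D)
  show ?thesis using assms by (rule D.borel_measurable_nn_integral)
qed

text \<open>Tonelli exchanges sum and expectation, each node is averaged independently of its
  weight, and the vertices are sorted by \<open>length\<close>.\<close>

lemma nn_integral_tree_sum:
  assumes [measurable]: "\<phi> \<in> borel_measurable borel"
    "(\<lambda>(l, p). H l p) \<in> borel_measurable (borel \<Otimes>\<^sub>M node_space)"
  shows "(\<integral>\<^sup>+\<omega>. \<integral>\<^sup>+v. H (weight \<phi> v (\<lambda>u. X u \<omega>)) (X v \<omega>) \<partial>count_space UNIV \<partial>M) =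
    (\<Sum>n. level \<phi> (\<lambda>l. \<integral>\<^sup>+p. H l p \<partial>D) n)"
proof -
  have "(\<integral>\<^sup>+\<omega>. \<integral>\<^sup>+v. H (weight \<phi> v (\<lambda>u. X u \<omega>)) (X v \<omega>) \<partial>count_space UNIV \<partial>M) =
      (\<integral>\<^sup>+v. \<integral>\<^sup>+\<omega>. H (weight \<phi> v (\<lambda>u. X u \<omega>)) (X v \<omega>) \<partial>M \<partial>count_space UNIV)"
    by (rule nn_integral_count_space_nn_integral) auto
  also have "\<dots> = (\<integral>\<^sup>+v. \<integral>\<^sup>+\<omega>. \<integral>\<^sup>+p. H (weight \<phi> v (\<lambda>u. X u \<omega>)) p \<partial>D \<partial>M \<partial>count_space UNIV)"
    using nn_integral_weight_node[of \<phi> "\<lambda>(l, p). H l p"] by simp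
  also have "\<dots> = (\<Sum>n. level \<phi> (\<lambda>l. \<integral>\<^sup>+p. H l p \<partial>D) n)"
    unfolding level_def by (subst nn_integral_count_space_fibres[where g=length]) simp
  finally show ?thesis .
qed

lemma nn_integral_tree_sum_mult:
  assumes [measurable]: "\<phi> \<in> borel_measurable borel" "f \<in> borel_measurable borel"
    "h \<in> borel_measurable node_space"
  shows "(\<integral>\<^sup>+\<omega>. \<integral>\<^sup>+v. f (weight \<phi> v (\<lambda>u. X u \<omega>)) * h (X v \<omega>) \<partial>count_space UNIV \<partial>M) =
    (\<Sum>n. level \<phi> f n) * (\<integral>\<^sup>+p. h p \<partial>D)"
proof -
  have "(\<integral>\<^sup>+\<omega>. \<integral>\<^sup>+v. f (weight \<phi> v (\<lambda>u. X u \<omega>)) * h (X v \<omega>) \<partial>count_space UNIV \<partial>M) =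
      (\<Sum>n. level \<phi> (\<lambda>l. \<integral>\<^sup>+p. f l * h p \<partial>D) n)"
    by (rule nn_integral_tree_sum) measurable
  also have "\<dots> = (\<Sum>n. (\<integral>\<^sup>+p. h p \<partial>D) * level \<phi> f n)"
    by (intro suminf_cong) (simp add: nn_integral_cmult level_cmult[symmetric] mult.commute)
  finally show ?thesis
    by (simp add: mult.commute)
qed

section \<open>Moments of the weights and the subcritical case\<close>

text \<open>Since \<open>0 powr \<theta> = 0\<close> for every \<open>\<theta>\<close>, zero entries
  contribute nothing, also for \<open>\<theta> \<le> 0\<close>. This makes it agree with
  \<open>m_fun\<close>.\<close>

definition mom :: "real \<Rightarrow> ennreal" where
  "mom \<theta> = (\<integral>\<^sup>+p. (\<Sum>i. ennreal (\<bar>snd p i\<bar> powr \<theta>)) \<partial>D)"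

lemma nn_integral_powr_scaled:
  "(\<integral>\<^sup>+p. (\<Sum>i. ennreal (\<bar>l * snd p i\<bar> powr \<theta>)) \<partial>D) = ennreal (\<bar>l\<bar> powr \<theta>) * mom \<theta>"
  by (simp add: abs_mult powr_mult ennreal_mult mom_def flip: nn_integral_cmult)

text \<open>The function \<open>\<bar>l\<bar> powr \<theta>\<close> is an eigenfunction of the mean
  transition operator with eigenvalue \<open>mom \<theta>\<close>.\<close>

lemma level_powr:
  "level (\<lambda>y. y) (\<lambda>l. ennreal (\<bar>l\<bar> powr \<theta>)) n = mom \<theta> ^ n"
proof (induction n)
  case (Suc n)
  have "level (\<lambda>y. y) (\<lambda>l. ennreal (\<bar>l\<bar> powr \<theta>)) (Suc n) =
      level (\<lambda>y. y) (\<lambda>l. mom \<theta> * ennreal (\<bar>l\<bar> powr \<theta>)) n"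
    by (subst level_Suc) (auto simp: nn_integral_powr_scaled mult.commute)
  then show ?case
    by (simp add: level_cmult Suc)
qed (simp add: level_0)

lemma measurable_tree_sum:
  assumes [measurable]: "\<phi> \<in> borel_measurable borel"
    "(\<lambda>(l, p). H l p) \<in> borel_measurable (borel \<Otimes>\<^sub>M node_space)"
  shows "(\<lambda>\<omega>. \<integral>\<^sup>+v. H (weight \<phi> v (\<lambda>u. X u \<omega>)) (X v \<omega>) \<partial>count_space UNIV) \<in> borel_measurable M"
  by (intro borel_measurable_nn_integral_count_space) auto

text \<open>The sum of the \<open>\<beta>\<close>-th powers of the terms has as mean a convergent
  geometric series times the \<open>\<beta>\<close>-th moment of the first node component. It is
  almost surely finite, and so is the sum of the terms, as \<open>\<beta> \<le> 1\<close>.\<close>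

lemma AE_tree_sum_finite_subcritical:
  assumes \<beta>: "0 < \<beta>" "\<beta> \<le> 1" and m: "mom \<beta> < 1"
    and c: "(\<integral>\<^sup>+p. ennreal (\<bar>fst p\<bar> powr \<beta>) \<partial>D) < \<infinity>"
  shows "AE \<omega> in M. (\<integral>\<^sup>+v. ennreal \<bar>weight (\<lambda>y. y) v (\<lambda>u. X u \<omega>) * fst (X v \<omega>)\<bar> \<partial>count_space UNIV) < \<infinity>"
proof -
  define r where "r = enn2real (mom \<beta>)"
  have "mom \<beta> < top" by (rule order.strict_trans[OF m]) simp
  then have r: "mom \<beta> = ennreal r" "0 \<le> r" by (auto simp: r_def)
  then have "r < 1" using m by simp
  have "(\<Sum>n. mom \<beta> ^ n) = ennreal (\<Sum>n. r ^ n)"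
    unfolding r using \<open>r < 1\<close> r(2) by (simp add: ennreal_power suminf_ennreal2 summable_geometric)
  then have fin: "(\<Sum>n. mom \<beta> ^ n) * (\<integral>\<^sup>+p. ennreal (\<bar>fst p\<bar> powr \<beta>) \<partial>D) < \<infinity>"
    using c by (simp add: ennreal_mult_less_top)
  have "(\<integral>\<^sup>+\<omega>. \<integral>\<^sup>+v. ennreal (\<bar>weight (\<lambda>y. y) v (\<lambda>u. X u \<omega>)\<bar> powr \<beta>) * ennreal (\<bar>fst (X v \<omega>)\<bar> powr \<beta>)
      \<partial>count_space UNIV \<partial>M) = (\<Sum>n. mom \<beta> ^ n) * (\<integral>\<^sup>+p. ennreal (\<bar>fst p\<bar> powr \<beta>) \<partial>D)"
    by (subst nn_integral_tree_sum_mult) (auto simp: level_powr[abs_def])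
  then have "AE \<omega> in M. (\<integral>\<^sup>+v. ennreal (\<bar>weight (\<lambda>y. y) v (\<lambda>u. X u \<omega>)\<bar> powr \<beta>) *
      ennreal (\<bar>fst (X v \<omega>)\<bar> powr \<beta>) \<partial>count_space UNIV) \<noteq> \<infinity>"
    using fin by (intro nn_integral_PInf_AE measurable_tree_sum) auto
  then show ?thesis
  proof eventually_elim
    case (elim \<omega>)
    then show ?case
      by (intro sum_abs_finite_if_sum_powr_finite[OF \<beta>])
         (simp add: abs_mult powr_mult ennreal_mult less_top)
  qed
qed

subsection \<open>The critical case\<close>

text \<open>The mean sum of \<open>\<bar>l\<bar> powr \<alpha>\<close> over a generation starts at 1
  and does not increase. Every cut removes more than \<open>K powr \<alpha>\<close> from it, so the
  mean number of cuts is limited by telescoping.\<close>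

lemma expected_exceedances:
  assumes \<alpha>: "0 < \<alpha>" "mom \<alpha> \<le> 1" and K: "1 \<le> K"
  shows "ennreal (K powr \<alpha>) * (\<integral>\<^sup>+\<omega>. \<integral>\<^sup>+v. (\<Sum>i. indicator {y. K < \<bar>y\<bar>}
    (weight (kill K) v (\<lambda>u. X u \<omega>) * snd (X v \<omega>) i)) \<partial>count_space UNIV \<partial>M) \<le> 1"
proof -
  define f where "f l = ennreal (\<bar>l\<bar> powr \<alpha>)" for l :: real
  define F where "F l = (\<integral>\<^sup>+p. (\<Sum>i. f (kill K (l * snd p i))) \<partial>D)" for l
  define e :: "real \<Rightarrow> ennreal" where "e = indicator {y. K < \<bar>y\<bar>}"
  define G where "G l = (\<integral>\<^sup>+p. (\<Sum>i. e (l * snd p i)) \<partial>D)" for l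
  have [measurable]: "f \<in> borel_measurable borel" "e \<in> borel_measurable borel"
    unfolding f_def e_def by measurable
  have [measurable]: "F \<in> borel_measurable borel" "G \<in> borel_measurable borel"
    unfolding F_def G_def by measurable
  let ?c = "ennreal (K powr \<alpha>)"
  have step: "F l + ?c * G l \<le> f l" for l
  proof -
    have "F l + ?c * G l = (\<integral>\<^sup>+p. (\<Sum>i. f (kill K (l * snd p i)) + ?c * e (l * snd p i)) \<partial>D)"
      unfolding F_def G_def by (simp add: suminf_add[symmetric] nn_integral_add nn_integral_cmult)
    also have "\<dots> \<le> (\<integral>\<^sup>+p. (\<Sum>i. ennreal (\<bar>l * snd p i\<bar> powr \<alpha>)) \<partial>D)"
    proof (intro nn_integral_mono suminf_le)
      fix p i
      \<comment> \<open>Either \<open>y\<close> survives and contributes its own power, or it is cut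
        and its power is at least \<open>K powr \<alpha>\<close>.\<close>
      have "K powr \<alpha> \<le> \<bar>y\<bar> powr \<alpha>" if "K < \<bar>y\<bar>" for y
        using that K \<alpha> by (intro powr_mono2) auto
      then show "f (kill K (l * snd p i)) + ?c * e (l * snd p i) \<le> ennreal (\<bar>l * snd p i\<bar> powr \<alpha>)"
        by (auto simp: f_def kill_def e_def split: split_indicator intro!: ennreal_leI)
    qed auto
    also have "\<dots> \<le> f l"
      using mult_left_mono[OF \<alpha>(2)] by (simp add: nn_integral_powr_scaled f_def)
    finally show ?thesis .
  qed
  have "level (kill K) f (Suc n) + ?c * level (kill K) G n \<le> level (kill K) f n" for n
    by (subst level_Suc) (auto simp: F_def[symmetric] level_add[symmetric] level_cmult[symmetric]
        intro!: level_mono step)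
  then have "(\<Sum>n. ?c * level (kill K) G n) \<le> level (kill K) f 0"
    by (rule suminf_le_of_telescope)
  also have "\<dots> = 1" by (simp add: level_0 f_def)
  finally show ?thesis
    unfolding e_def[symmetric]
    by (subst nn_integral_tree_sum) (auto simp: G_def[abs_def])
qed

text \<open>
  In \<open>g l = A \<bar>l\<bar>\<^sup>\<alpha> - \<bar>l\<bar>\<^sup>\<theta>\<close> with \<open>\<theta> = \<alpha> + \<kappa>\<close>, the truncation at \<open>0\<close> is done by \<^const>\<open>ennreal\<close>. It adds at most
  \<open>m(\<alpha> + 2\<kappa>) \<bar>l\<bar>\<^sup>\<alpha>\<^sup>+\<^sup>2\<^sup>\<kappa> / A\<close> to the expected sum of \<open>g\<close> over the children of a vertex of weight \<open>l\<close>, which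
  is negligible for large \<open>A\<close> because \<open>\<bar>l\<bar> \<le> K\<close>.
\<close>

lemma killed_level_sum_finite:
  assumes \<kappa>: "0 < \<kappa>" and m\<alpha>: "mom \<alpha> \<le> 1"
    and m1: "1 < mom (\<alpha> + \<kappa>)" "mom (\<alpha> + \<kappa>) < \<infinity>" and m2: "mom (\<alpha> + 2 * \<kappa>) < \<infinity>"
    and K: "1 \<le> K"
  shows "(\<Sum>n. level (kill K) (\<lambda>l. ennreal (\<bar>l\<bar> powr (\<alpha> + \<kappa>))) n) < \<infinity>"
proof -
  define \<theta> where "\<theta> = \<alpha> + \<kappa>"
  define \<theta>' where "\<theta>' = \<alpha> + 2 * \<kappa>"
  define \<mu> where "\<mu> = enn2real (mom \<theta>)"
  define \<mu>' where "\<mu>' = enn2real (mom \<theta>')"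
  have \<mu>: "mom \<theta> = ennreal \<mu>" using m1 by (simp add: \<mu>_def \<theta>_def)
  have \<mu>': "mom \<theta>' = ennreal \<mu>'" "0 \<le> \<mu>'" using m2 by (auto simp: \<mu>'_def \<theta>'_def)
  have \<mu>1: "1 < \<mu>" using m1 \<mu> by (simp add: \<theta>_def)
  \<comment> \<open>Half of the excess \<open>\<mu> - 1\<close> is kept as the gain
    \<open>\<delta>\<close>; the other half pays for the truncation.\<close>
  define \<delta> where "\<delta> = (\<mu> - 1) / 2"
  have \<delta>: "0 < \<delta>" using \<mu>1 by (simp add: \<delta>_def)
  \<comment> \<open>Makes the truncation cost \<open>K powr \<kappa> * \<mu>' / A\<close> at most
    \<open>\<delta>\<close>; the summand 1 keeps \<open>A\<close> positive.\<close>
  define A where "A = K powr \<kappa> * \<mu>' / \<delta> + 1"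
  have A: "1 \<le> A" using \<delta> \<mu>' by (simp add: A_def)
  have A\<delta>: "K powr \<kappa> * \<mu>' / A \<le> \<delta>"
    using A \<delta> by (simp add: A_def field_simps)
  define g where "g l = ennreal (A * \<bar>l\<bar> powr \<alpha> - \<bar>l\<bar> powr \<theta>)" for l :: real
  define f where "f l = ennreal (\<bar>l\<bar> powr \<theta>)" for l :: real
  define G where "G l = (\<integral>\<^sup>+p. (\<Sum>i. g (kill K (l * snd p i))) \<partial>D)" for l
  have [measurable]: "f \<in> borel_measurable borel" "g \<in> borel_measurable borel"
    unfolding f_def g_def by measurable
  have [measurable]: "G \<in> borel_measurable borel"
    unfolding G_def by measurable
  have pointwise: "g (kill K y) + ennreal (\<bar>y\<bar> powr \<theta>) \<le>
      ennreal A * ennreal (\<bar>y\<bar> powr \<alpha>) + ennreal (1 / A) * ennreal (\<bar>y\<bar> powr \<theta>')" for y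
  proof -
    define a where "a = A * \<bar>y\<bar> powr \<alpha>"
    define b where "b = \<bar>y\<bar> powr \<theta>' / A"
    have ab: "0 \<le> a" "0 \<le> b" using A by (auto simp: a_def b_def)
    \<comment> \<open>As \<open>\<theta>\<close> is the midpoint of \<open>\<alpha>\<close> and
      \<open>\<theta>'\<close>, the power at \<open>\<theta>\<close> is the geometric mean of
      \<open>a\<close> and \<open>b\<close>, hence at most \<open>a + b\<close>.\<close>
    have "(\<bar>y\<bar> powr \<theta>)\<^sup>2 = a * b"
      using A by (simp add: a_def b_def power2_eq_square \<theta>_def \<theta>'_def flip: powr_add)
    also have "\<dots> \<le> (a + b)\<^sup>2"
      using ab by (simp add: power2_sum)
    finally have le: "\<bar>y\<bar> powr \<theta> \<le> a + b"
      by (rule power2_le_imp_le) (use ab in simp)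
    have "g (kill K y) + ennreal (\<bar>y\<bar> powr \<theta>) \<le> ennreal (a - \<bar>y\<bar> powr \<theta>) + ennreal (\<bar>y\<bar> powr \<theta>)"
      by (auto simp: g_def kill_def a_def)
    also have "\<dots> = ennreal (max a (\<bar>y\<bar> powr \<theta>))"
    proof (cases "\<bar>y\<bar> powr \<theta> \<le> a")
      case True
      then show ?thesis by (simp flip: ennreal_plus)
    next
      case False
      then show ?thesis by (simp add: ennreal_neg max_def)
    qed
    also have "\<dots> \<le> ennreal (a + b)"
      using le ab by (intro ennreal_leI) auto
    finally show ?thesis
      using ab A by (simp add: a_def b_def ennreal_mult'[symmetric])
  qed
  have step: "G l + ennreal \<delta> * f l \<le> g l" if l: "\<bar>l\<bar> \<le> K" for l
  proof -
    define s where "s = \<bar>l\<bar> powr \<theta>"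
    define a where "a = \<bar>l\<bar> powr \<alpha>"
    define b where "b = \<bar>l\<bar> powr \<theta>'"
    have nn: "0 \<le> s" "0 \<le> a" "0 \<le> b" by (auto simp: s_def a_def b_def)
    \<comment> \<open>The negative part of \<open>g\<close> is moved to the left, so that no
      subtraction in \<open>ennreal\<close> occurs.\<close>
    have "G l + ennreal s * mom \<theta> =
        (\<integral>\<^sup>+p. (\<Sum>i. g (kill K (l * snd p i)) + ennreal (\<bar>l * snd p i\<bar> powr \<theta>)) \<partial>D)"
      unfolding G_def s_def nn_integral_powr_scaled[symmetric]
      by (simp add: suminf_add[symmetric] nn_integral_add)
    also have "\<dots> \<le> (\<integral>\<^sup>+p. (\<Sum>i. ennreal A * ennreal (\<bar>l * snd p i\<bar> powr \<alpha>) +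
        ennreal (1 / A) * ennreal (\<bar>l * snd p i\<bar> powr \<theta>')) \<partial>D)"
      by (intro nn_integral_mono suminf_le pointwise) auto
    also have "\<dots> = ennreal A * (ennreal a * mom \<alpha>) + ennreal (1 / A) * (ennreal b * mom \<theta>')"
      unfolding a_def b_def nn_integral_powr_scaled[symmetric]
      by (simp add: suminf_add[symmetric] nn_integral_add nn_integral_cmult)
    also have "\<dots> \<le> ennreal A * (ennreal a * 1) + ennreal (1 / A) * (ennreal b * mom \<theta>')"
      by (intro add_right_mono mult_left_mono m\<alpha>) auto
    also have "\<dots> = ennreal (A * a + b * \<mu>' / A)"
      using nn A \<mu>' by (simp add: ennreal_mult'[symmetric])
    also have "\<dots> \<le> ennreal (A * a + \<delta> * s)"
    proof (intro ennreal_leI add_left_mono)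
      \<comment> \<open>The bound \<open>\<bar>l\<bar> \<le> K\<close> enters here: it turns the
        power at \<open>\<theta>'\<close> into one at \<open>\<theta>\<close>.\<close>
      have "b = \<bar>l\<bar> powr \<kappa> * s"
        by (simp add: b_def s_def \<theta>_def \<theta>'_def ac_simps flip: powr_add)
      also have "\<dots> \<le> K powr \<kappa> * s"
        using l \<kappa> nn by (intro mult_right_mono powr_mono2) auto
      finally have "b * \<mu>' / A \<le> K powr \<kappa> * s * \<mu>' / A"
        using A \<mu>' by (intro divide_right_mono mult_right_mono) auto
      also have "\<dots> = K powr \<kappa> * \<mu>' / A * s" by simp
      also have "\<dots> \<le> \<delta> * s"
        using A\<delta> nn by (intro mult_right_mono) auto
      finally show "b * \<mu>' / A \<le> \<delta> * s" .
    qed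
    finally have le: "G l + ennreal (s * \<mu>) \<le> ennreal (A * a + \<delta> * s)"
      using nn \<mu>1 by (simp add: \<mu> ennreal_mult)
    have "G l \<le> G l + ennreal (s * \<mu>)" by simp
    also note le
    finally have "G l < top" by (simp add: le_less_trans)
    then obtain r where r: "G l = ennreal r" "0 \<le> r"
      by (cases "G l") auto
    have "r + s * \<mu> \<le> A * a + \<delta> * s"
      using le r nn \<mu>1 A \<delta> by (simp flip: ennreal_plus)
    \<comment> \<open>Here \<open>\<mu> = 1 + 2 * \<delta>\<close>, and \<open>G l\<close> is
      finite, so terms may be moved across in the reals.\<close>
    then have "r + \<delta> * s \<le> A * a - s"
      by (simp add: \<delta>_def field_simps)
    then have "ennreal (r + \<delta> * s) \<le> g l"
      by (simp add: g_def a_def s_def ennreal_leI)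
    then show ?thesis
      using r nn \<delta> by (simp add: f_def s_def ennreal_mult)
  qed
  have "level (kill K) g (Suc n) + ennreal \<delta> * level (kill K) f n \<le> level (kill K) g n" for n
    by (subst level_Suc) (auto simp: G_def[symmetric] level_add[symmetric] level_cmult[symmetric]
        intro!: level_mono step abs_weight_kill_le K)
  then have "(\<Sum>n. ennreal \<delta> * level (kill K) f n) \<le> level (kill K) g 0"
    by (rule suminf_le_of_telescope)
  also have "\<dots> < \<infinity>" by (simp add: level_0 g_def)
  finally show ?thesis
    using \<delta> by (auto simp: f_def[symmetric] \<theta>_def[symmetric] ennreal_mult_less_top)
qed

text \<open>Killed weights are at most \<open>K\<close> and the exponent
  \<open>\<theta> = \<alpha> + \<kappa>\<close> is at most 1, so \<open>\<bar>l\<bar>\<close> is at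
  most \<open>K powr (1 - \<theta>) * \<bar>l\<bar> powr \<theta>\<close>. The finite sum over
  generations at exponent \<open>\<theta>\<close> then gives a finite mean.\<close>

lemma AE_killed_sum_finite:
  assumes \<kappa>: "0 < \<kappa>" and m\<alpha>: "mom \<alpha> \<le> 1"
    and m1: "1 < mom (\<alpha> + \<kappa>)" "mom (\<alpha> + \<kappa>) < \<infinity>" and m2: "mom (\<alpha> + 2 * \<kappa>) < \<infinity>"
    and \<theta>1: "\<alpha> + \<kappa> \<le> 1" and c: "(\<integral>\<^sup>+p. ennreal \<bar>fst p\<bar> \<partial>D) < \<infinity>" and K: "1 \<le> K"
  shows "AE \<omega> in M. (\<integral>\<^sup>+v. ennreal \<bar>weight (kill K) v (\<lambda>u. X u \<omega>) * fst (X v \<omega>)\<bar> \<partial>count_space UNIV) < \<infinity>"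
proof -
  define \<theta> where "\<theta> = \<alpha> + \<kappa>"
  have "level (kill K) (\<lambda>l. ennreal \<bar>l\<bar>) n \<le>
      ennreal (K powr (1 - \<theta>)) * level (kill K) (\<lambda>l. ennreal (\<bar>l\<bar> powr \<theta>)) n" for n
  proof (subst level_cmult[symmetric])
    show "level (kill K) (\<lambda>l. ennreal \<bar>l\<bar>) n \<le>
        level (kill K) (\<lambda>l. ennreal (K powr (1 - \<theta>)) * ennreal (\<bar>l\<bar> powr \<theta>)) n"
    proof (rule level_mono)
      fix v x
      let ?l = "weight (kill K) v x"
      have "\<bar>?l\<bar> = \<bar>?l\<bar> powr (1 - \<theta>) * \<bar>?l\<bar> powr \<theta>"
        by (simp flip: powr_add)
      also have "\<dots> \<le> K powr (1 - \<theta>) * \<bar>?l\<bar> powr \<theta>"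
        using abs_weight_kill_le[OF K] \<theta>1 by (intro mult_right_mono powr_mono2) (auto simp: \<theta>_def)
      finally show "ennreal \<bar>?l\<bar> \<le> ennreal (K powr (1 - \<theta>)) * ennreal (\<bar>?l\<bar> powr \<theta>)"
        by (simp add: ennreal_leI flip: ennreal_mult)
    qed
  qed auto
  then have "(\<Sum>n. level (kill K) (\<lambda>l. ennreal \<bar>l\<bar>) n) \<le>
      (\<Sum>n. ennreal (K powr (1 - \<theta>)) * level (kill K) (\<lambda>l. ennreal (\<bar>l\<bar> powr \<theta>)) n)"
    by (intro suminf_le) auto
  also have "\<dots> < \<infinity>"
    using killed_level_sum_finite[OF \<kappa> m\<alpha> m1 m2 K] by (simp add: ennreal_mult_less_top \<theta>_def)
  finally have fin: "(\<Sum>n. level (kill K) (\<lambda>l. ennreal \<bar>l\<bar>) n) * (\<integral>\<^sup>+p. ennreal \<bar>fst p\<bar> \<partial>D) < \<infinity>"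
    using c by (simp add: ennreal_mult_less_top)
  have "(\<integral>\<^sup>+\<omega>. \<integral>\<^sup>+v. ennreal \<bar>weight (kill K) v (\<lambda>u. X u \<omega>)\<bar> * ennreal \<bar>fst (X v \<omega>)\<bar>
      \<partial>count_space UNIV \<partial>M) = (\<Sum>n. level (kill K) (\<lambda>l. ennreal \<bar>l\<bar>) n) * (\<integral>\<^sup>+p. ennreal \<bar>fst p\<bar> \<partial>D)"
    by (rule nn_integral_tree_sum_mult) auto
  then have "AE \<omega> in M. (\<integral>\<^sup>+v. ennreal \<bar>weight (kill K) v (\<lambda>u. X u \<omega>)\<bar> *
      ennreal \<bar>fst (X v \<omega>)\<bar> \<partial>count_space UNIV) \<noteq> \<infinity>"
    using fin by (intro nn_integral_PInf_AE measurable_tree_sum) auto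
  then show ?thesis
    by (simp add: abs_mult ennreal_mult less_top)
qed

text \<open>If the full sum is infinite while the killed one is finite, the two trees differ and
  some weight exceeds \<open>K\<close>. The probability of this is at most
  \<open>K powr (- \<alpha>)\<close>, for every \<open>K \<ge> 1\<close>.\<close>

lemma AE_tree_sum_finite_critical:
  assumes \<alpha>: "0 < \<alpha>" and \<kappa>: "0 < \<kappa>" and m\<alpha>: "mom \<alpha> \<le> 1"
    and m1: "1 < mom (\<alpha> + \<kappa>)" "mom (\<alpha> + \<kappa>) < \<infinity>" and m2: "mom (\<alpha> + 2 * \<kappa>) < \<infinity>"
    and \<theta>1: "\<alpha> + \<kappa> \<le> 1" and c: "(\<integral>\<^sup>+p. ennreal \<bar>fst p\<bar> \<partial>D) < \<infinity>"
  shows "AE \<omega> in M. (\<integral>\<^sup>+v. ennreal \<bar>weight (\<lambda>y. y) v (\<lambda>u. X u \<omega>) * fst (X v \<omega>)\<bar> \<partial>count_space UNIV) < \<infinity>"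
proof -
  define S where "S \<phi> \<omega> = (\<integral>\<^sup>+v. ennreal \<bar>weight \<phi> v (\<lambda>u. X u \<omega>) * fst (X v \<omega>)\<bar> \<partial>count_space UNIV)"
    for \<phi> \<omega>
  have [measurable]: "S \<phi> \<in> borel_measurable M" if [measurable]: "\<phi> \<in> borel_measurable borel" for \<phi>
    unfolding S_def[abs_def] by (rule measurable_tree_sum) auto
  define E where "E K \<omega> = (\<integral>\<^sup>+v. (\<Sum>i. indicator {y. K < \<bar>y\<bar>}
    (weight (kill K) v (\<lambda>u. X u \<omega>) * snd (X v \<omega>) i)) \<partial>count_space UNIV :: ennreal)" for K \<omega>
  have [measurable]: "E K \<in> borel_measurable M" for K
    unfolding E_def[abs_def] by (rule measurable_tree_sum) auto
  define N where "N = {\<omega>\<in>space M. S (\<lambda>y. y) \<omega> = \<infinity>}"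
  have [measurable]: "N \<in> sets M"
    unfolding N_def by measurable
  have bound: "ennreal (K powr \<alpha>) * emeasure M N \<le> 1" if K: "1 \<le> K" for K
  proof -
    have "AE \<omega> in M. indicator N \<omega> \<le> E K \<omega>"
      using AE_killed_sum_finite[OF \<kappa> m\<alpha> m1 m2 \<theta>1 c K] AE_space
    proof eventually_elim
      case (elim \<omega>)
      show ?case
      proof (cases "\<omega> \<in> N")
        case True
        have "\<exists>v i. K < \<bar>weight (kill K) v (\<lambda>u. X u \<omega>) * snd (X v \<omega>) i\<bar>"
        proof (rule ccontr)
          assume "\<not> ?thesis"
          then have "weight (kill K) v (\<lambda>u. X u \<omega>) = weight (\<lambda>y. y) v (\<lambda>u. X u \<omega>)" for v
            by (intro weight_kill_eq_weight) (auto simp: not_less)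
          then show False
            using elim True by (simp add: N_def S_def)
        qed
        then obtain v i where vi: "K < \<bar>weight (kill K) v (\<lambda>u. X u \<omega>) * snd (X v \<omega>) i\<bar>"
          by blast
        have "1 = (\<Sum>j\<in>{i}. indicator {y. K < \<bar>y\<bar>} (weight (kill K) v (\<lambda>u. X u \<omega>) * snd (X v \<omega>) j) :: ennreal)"
          using vi by simp
        also have "\<dots> \<le> (\<Sum>j. indicator {y. K < \<bar>y\<bar>} (weight (kill K) v (\<lambda>u. X u \<omega>) * snd (X v \<omega>) j))"
          by (rule sum_le_suminf) auto
        also have "\<dots> \<le> E K \<omega>"
          unfolding E_def by (rule nn_integral_ge_point) simp
        finally show ?thesis using True by simp
      qed simp
    qed
    then have "(\<integral>\<^sup>+\<omega>. indicator N \<omega> \<partial>M) \<le> (\<integral>\<^sup>+\<omega>. E K \<omega> \<partial>M)"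
      by (rule nn_integral_mono_AE)
    then have "emeasure M N \<le> (\<integral>\<^sup>+\<omega>. E K \<omega> \<partial>M)"
      by simp
    then have "ennreal (K powr \<alpha>) * emeasure M N \<le> ennreal (K powr \<alpha>) * (\<integral>\<^sup>+\<omega>. E K \<omega> \<partial>M)"
      by (intro mult_left_mono) auto
    also have "\<dots> \<le> 1"
      unfolding E_def by (rule expected_exceedances[OF \<alpha> m\<alpha> K])
    finally show ?thesis .
  qed
  have "prob N = 0"
  proof (rule ccontr)
    assume "prob N \<noteq> 0"
    then have pos: "0 < prob N" by (simp add: less_le)
    \<comment> \<open>With this choice \<open>K powr \<alpha> * prob N = 2\<close>, which
      contradicts \<open>bound\<close>.\<close>
    define K where "K = (2 / prob N) powr (1 / \<alpha>)"
    have "1 \<le> 2 / prob N" using pos order_trans[OF prob_le_1[of N], of 2] by (simp add: field_simps)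
    then have "1 \<le> K" unfolding K_def using \<alpha> by (intro ge_one_powr_ge_zero) auto
    then have "ennreal (K powr \<alpha> * prob N) \<le> 1"
      using bound[of K] by (simp add: emeasure_eq_measure ennreal_mult)
    moreover have "K powr \<alpha> = 2 / prob N"
      using pos \<alpha> by (simp add: K_def powr_powr)
    ultimately show False using pos by (simp flip: ennreal_1)
  qed
  then have "AE \<omega> in M. \<omega> \<notin> N"
    by (intro AE_not_in) (simp add: null_sets_def emeasure_eq_measure)
  then show ?thesis
    using AE_space by eventually_elim (auto simp: N_def S_def less_top)
qed

subsection \<open>The fixed point\<close>

text \<open>An injective relabelling of an i.i.d. family keeps its joint law. With
  \<open>Cons i\<close> and the identity it shows that a subtree of the root has the law of the
  whole tree.\<close>

lemma distr_reindexed_tree: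
  fixes g :: "nat list \<Rightarrow> nat list"
  assumes "inj g"
  shows "distr M (PiM UNIV (\<lambda>_. node_space)) (\<lambda>\<omega> v. X (g v) \<omega>) = PiM UNIV (\<lambda>_. D)"
proof -
  have [measurable]: "(\<lambda>\<omega> v. X v \<omega>) \<in> M \<rightarrow>\<^sub>M PiM UNIV (\<lambda>_. node_space)"
    by (rule measurable_tree)
  have sets: "sets (PiM UNIV (\<lambda>_. D)) = sets (PiM (UNIV :: nat list set) (\<lambda>_. node_space))"
    by (intro sets_PiM_cong sets_D refl)
  have [measurable]: "(\<lambda>x v. x (g v)) \<in> PiM UNIV (\<lambda>_. node_space) \<rightarrow>\<^sub>M PiM (UNIV :: nat list set) (\<lambda>_. node_space)"
    by (rule measurable_PiM_single') (auto simp: space_PiM)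
  have "distr M (PiM UNIV (\<lambda>_. node_space)) (\<lambda>\<omega> v. X (g v) \<omega>) =
      distr (distr M (PiM UNIV (\<lambda>_. node_space)) (\<lambda>\<omega> v. X v \<omega>)) (PiM UNIV (\<lambda>_. node_space)) (\<lambda>x v. x (g v))"
    by (subst distr_distr) (auto simp: comp_def)
  also have "distr M (PiM UNIV (\<lambda>_. node_space)) (\<lambda>\<omega> v. X v \<omega>) = PiM UNIV (\<lambda>_. D)"
    using indep indep_vars_iff_distr_eq_PiM[where I=UNIV and M'="\<lambda>_. node_space" and X=X] by (simp add: law restrict_def)
  also have "distr (PiM UNIV (\<lambda>_. D)) (PiM UNIV (\<lambda>_. node_space)) (\<lambda>x v. x (g v)) =
      distr (PiM UNIV (\<lambda>_. D)) (PiM UNIV (\<lambda>_. D)) (\<lambda>x v. x (g v))"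
    by (intro distr_cong) (auto simp: sets)
  also have "\<dots> = PiM UNIV (\<lambda>_. D)"
    using distr_PiM_reindex[of UNIV "\<lambda>_. D" g UNIV] assms prob_space_D
    by (simp add: restrict_def)
  finally show ?thesis .
qed

text \<open>Fixed points are laws on the reals, hence \<open>enn2real\<close>. It sends an infinite
  total to 0, so this is the law of the total once that is almost surely finite.\<close>

definition limit_law :: "real measure" where
  "limit_law = distr M borel (\<lambda>\<omega>. enn2real (total_weight (\<lambda>v. X v \<omega>)))"

text \<open>The index set is a parameter because independence is stated for restricted families:
  \<open>range (Cons i)\<close> for one subtree, all nonempty lists for the subtrees
  together.\<close>

lemma measurable_subtree:
  assumes "range (Cons i) \<subseteq> A"
  shows "(\<lambda>x. enn2real (total_weight (\<lambda>u. x (i # u)))) \<in> borel_measurable (PiM A (\<lambda>_. node_space))"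
proof -
  have "(\<lambda>x u. x (i # u)) \<in> PiM A (\<lambda>_. node_space) \<rightarrow>\<^sub>M PiM UNIV (\<lambda>_. node_space)"
    by (rule measurable_PiM_single')
       (use assms in \<open>auto simp: space_PiM PiE_iff intro!: measurable_component_singleton\<close>)
  then show ?thesis by measurable
qed

lemma measurable_subtree_node: "(\<lambda>\<omega> u. X (i # u) \<omega>) \<in> M \<rightarrow>\<^sub>M PiM UNIV (\<lambda>_. node_space)"
  by (rule measurable_PiM_single') (auto dest: measurable_space[OF measurable_node])

lemma distr_subtree: "distr M borel (\<lambda>\<omega>. enn2real (total_weight (\<lambda>u. X (i # u) \<omega>))) = limit_law"
proof -
  have "distr M borel (\<lambda>\<omega>. enn2real (total_weight (\<lambda>u. X (i # u) \<omega>))) =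
      distr (distr M (PiM UNIV (\<lambda>_. node_space)) (\<lambda>\<omega> u. X (i # u) \<omega>)) borel (\<lambda>x. enn2real (total_weight x))"
    using measurable_subtree_node by (subst distr_distr) (auto simp: comp_def)
  also have "distr M (PiM UNIV (\<lambda>_. node_space)) (\<lambda>\<omega> u. X (i # u) \<omega>) =
      distr M (PiM UNIV (\<lambda>_. node_space)) (\<lambda>\<omega> u. X u \<omega>)"
    using distr_reindexed_tree[of "Cons i"] distr_reindexed_tree[of "\<lambda>u. u"] by simp
  also have "distr \<dots> borel (\<lambda>x. enn2real (total_weight x)) = limit_law"
    using measurable_tree by (subst distr_distr) (auto simp: comp_def limit_law_def)
  finally show ?thesis .
qed

text \<open>Disjoint blocks of nodes are independent. The blocks \<open>range (Cons i)\<close> give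
  independence among the subtrees; the root against all nonempty lists gives independence of the
  root from their sequence.\<close>

lemma distr_root_subtrees:
  "D \<Otimes>\<^sub>M PiM UNIV (\<lambda>_. limit_law) = distr M (node_space \<Otimes>\<^sub>M PiM UNIV (\<lambda>_. borel))
    (\<lambda>\<omega>. (X [] \<omega>, \<lambda>i. enn2real (total_weight (\<lambda>u. X (i # u) \<omega>))))"
proof -
  define Y where "Y i \<omega> = enn2real (total_weight (\<lambda>u. X (i # u) \<omega>))" for i \<omega>
  have [measurable]: "Y i \<in> borel_measurable M" for i
    unfolding Y_def[abs_def] using measurable_subtree_node by measurable
  have "indep_vars (\<lambda>i. PiM (range (Cons i)) (\<lambda>_. node_space))
      (\<lambda>i \<omega>. restrict (\<lambda>u. X u \<omega>) (range (Cons i))) UNIV"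
    by (rule indep_vars_restrict[OF indep]) (auto simp: disjoint_family_on_def)
  then have "indep_vars (\<lambda>_. borel) (\<lambda>i \<omega>. enn2real (total_weight
      (\<lambda>u. restrict (\<lambda>u. X u \<omega>) (range (Cons i)) (i # u)))) UNIV"
    by (rule indep_vars_compose2) (auto intro!: measurable_subtree)
  then have "indep_vars (\<lambda>_. borel) Y UNIV"
    by (simp add: Y_def[abs_def])
  moreover have "distr M borel (Y i) = limit_law" for i
    using distr_subtree[of i] by (simp add: Y_def[abs_def])
  ultimately have Y: "distr M (PiM UNIV (\<lambda>_. borel)) (\<lambda>\<omega> i. Y i \<omega>) = PiM UNIV (\<lambda>_. limit_law)"
    using indep_vars_iff_distr_eq_PiM[where I=UNIV and M'="\<lambda>_. borel" and X=Y]
    by (simp add: restrict_def)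
  let ?B = "{v::nat list. v \<noteq> []}"
  have "indep_var (PiM {[]} (\<lambda>_. node_space)) (\<lambda>\<omega>. restrict (\<lambda>u. X u \<omega>) {[]})
      (PiM ?B (\<lambda>_. node_space)) (\<lambda>\<omega>. restrict (\<lambda>u. X u \<omega>) ?B)"
    by (rule indep_var_restrict[OF indep]) auto
  then have "distr M node_space (\<lambda>\<omega>. restrict (\<lambda>u. X u \<omega>) {[]} []) \<Otimes>\<^sub>M
      distr M (PiM UNIV (\<lambda>_. borel)) (\<lambda>\<omega> i. enn2real (total_weight (\<lambda>u. restrict (\<lambda>u. X u \<omega>) ?B (i # u)))) =
      distr M (node_space \<Otimes>\<^sub>M PiM UNIV (\<lambda>_. borel)) (\<lambda>\<omega>. (restrict (\<lambda>u. X u \<omega>) {[]} [],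
        \<lambda>i. enn2real (total_weight (\<lambda>u. restrict (\<lambda>u. X u \<omega>) ?B (i # u)))))"
    by (rule distr_Pair_of_indep_var)
       (auto intro!: measurable_component_singleton measurable_PiM_single' measurable_subtree)
  then show ?thesis
    using Y by (simp add: law Y_def)
qed

text \<open>The recursion for \<open>total_weight\<close> holds almost surely as an equation of
  random variables, and \<open>distr_root_subtrees\<close> identifies the law of its right-hand
  side.\<close>

lemma limit_law_fixed_point:
  assumes nonneg: "AE p in D. 0 \<le> fst p \<and> (\<forall>i. 0 \<le> snd p i)"
    and finite: "AE \<omega> in M. total_weight (\<lambda>v. X v \<omega>) < \<infinity>"
  shows "limit_law \<in> fixed_points M (\<lambda>\<omega>. fst (X [] \<omega>)) (\<lambda>i \<omega>. snd (X [] \<omega>) i)"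
proof -
  note measurable_tree [measurable] measurable_subtree_node [measurable]
  have sets [measurable_cong]: "sets limit_law = sets borel" by (simp add: limit_law_def)
  have prob: "prob_space limit_law"
    unfolding limit_law_def by (rule prob_space_distr) measurable
  define \<Phi> :: "(real \<times> (nat \<Rightarrow> real)) \<times> (nat \<Rightarrow> real) \<Rightarrow> ennreal"
    where "\<Phi> = (\<lambda>(p, x). ennreal (fst p) + (\<Sum>i. ennreal (snd p i * x i)))"
  have \<Phi> [measurable]: "\<Phi> \<in> borel_measurable (node_space \<Otimes>\<^sub>M PiM UNIV (\<lambda>_. borel))"
    unfolding \<Phi>_def by measurable
  have pair: "(\<lambda>\<omega>. (X [] \<omega>, \<lambda>i. enn2real (total_weight (\<lambda>u. X (i # u) \<omega>)))) \<in>
      M \<rightarrow>\<^sub>M node_space \<Otimes>\<^sub>M PiM UNIV (\<lambda>_. borel)"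
    by (intro measurable_Pair measurable_PiM_single') auto
  let ?P = "PiM (UNIV :: nat set) (\<lambda>_. limit_law)"
  have prob_P: "prob_space ?P" using prob by (rule prob_space_PiM)
  have "AE \<omega> in M. 0 \<le> fst (X v \<omega>) \<and> (\<forall>i. 0 \<le> snd (X v \<omega>) i)" for v
    using nonneg unfolding law[of v, symmetric] by (subst (asm) AE_distr_iff) auto
  then have nonneg': "AE \<omega> in M. \<forall>v. 0 \<le> fst (X v \<omega>) \<and> (\<forall>i. 0 \<le> snd (X v \<omega>) i)"
    by (subst AE_all_countable) simp
  \<comment> \<open>Finiteness passes to each subtree by equality in law. Without it
    \<open>enn2real\<close> could replace an infinite subtree total by 0 and break the
    recursion.\<close>
  have "AE \<omega> in M. total_weight (\<lambda>u. X (i # u) \<omega>) < \<infinity>" for i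
  proof -
    have "AE x in distr M (PiM UNIV (\<lambda>_. node_space)) (\<lambda>\<omega> v. X v \<omega>). total_weight x < \<infinity>"
      using finite by (subst AE_distr_iff) auto
    also have "distr M (PiM UNIV (\<lambda>_. node_space)) (\<lambda>\<omega> v. X v \<omega>) =
        distr M (PiM UNIV (\<lambda>_. node_space)) (\<lambda>\<omega> v. X (i # v) \<omega>)"
      using distr_reindexed_tree[of "Cons i"] distr_reindexed_tree[of "\<lambda>u. u"] by simp
    finally show ?thesis
      by (subst (asm) AE_distr_iff) auto
  qed
  then have finite': "AE \<omega> in M. \<forall>i. total_weight (\<lambda>u. X (i # u) \<omega>) < \<infinity>"
    by (subst AE_all_countable) simp
  have "distr limit_law borel ennreal =
      distr M borel (\<lambda>\<omega>. ennreal (enn2real (total_weight (\<lambda>v. X v \<omega>))))"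
    unfolding limit_law_def by (subst distr_distr) (auto simp: comp_def)
  also have "\<dots> = distr M borel (\<lambda>\<omega>. \<Phi> (X [] \<omega>, \<lambda>i. enn2real (total_weight (\<lambda>u. X (i # u) \<omega>))))"
  proof (rule distr_cong_AE)
    show "AE \<omega> in M. ennreal (enn2real (total_weight (\<lambda>v. X v \<omega>))) =
        \<Phi> (X [] \<omega>, \<lambda>i. enn2real (total_weight (\<lambda>u. X (i # u) \<omega>)))"
      using finite finite' nonneg'
    proof eventually_elim
      case (elim \<omega>)
      then have "total_weight (\<lambda>v. X v \<omega>) = ennreal (fst (X [] \<omega>)) +
          (\<Sum>i. ennreal (snd (X [] \<omega>) i) * total_weight (\<lambda>u. X (i # u) \<omega>))"
        by (intro total_weight_recursion) auto
      with elim show ?case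
        by (simp add: \<Phi>_def ennreal_mult)
    qed
  qed (use measurable_compose[OF pair \<Phi>] in auto)
  also have "\<dots> = distr (D \<Otimes>\<^sub>M ?P) borel \<Phi>"
    unfolding distr_root_subtrees using pair by (subst distr_distr) (auto simp: comp_def)
  \<comment> \<open>\<open>fixed_points\<close> uses a product with \<open>M\<close> rather than
    with \<open>D\<close>, so \<open>D\<close> is written as the law of the root node and the second
    coordinate is carried along unchanged.\<close>
  also have "D \<Otimes>\<^sub>M ?P = distr M node_space (X []) \<Otimes>\<^sub>M distr ?P ?P (\<lambda>x. x)"
    by (simp add: law)
  also have "\<dots> = distr (M \<Otimes>\<^sub>M ?P) (node_space \<Otimes>\<^sub>M ?P) (\<lambda>(\<omega>, x). (X [] \<omega>, x))"
    by (rule pair_measure_distr)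
       (use prob_P in \<open>auto intro: finite_measure.axioms prob_space.axioms\<close>)
  also have "distr \<dots> borel \<Phi> = distr (M \<Otimes>\<^sub>M ?P) borel
      (\<lambda>(\<omega>, x). ennreal (fst (X [] \<omega>)) + (\<Sum>i. ennreal (snd (X [] \<omega>) i * x i)))"
    by (subst distr_distr) (auto simp: comp_def \<Phi>_def case_prod_unfold)
  finally have "distr limit_law borel ennreal = \<dots>" .
  moreover have "AE x in limit_law. 0 \<le> x"
    unfolding limit_law_def by (subst AE_distr_iff) auto
  ultimately show ?thesis
    using prob sets by (simp add: fixed_points_def)
qed

end

section \<open>Application of the tree results to the given weighted branching model\<close>

theorem theorem7p1:
  fixes M :: "'w measure"
    and C :: "'w \<Rightarrow> real" and T :: "nat \<Rightarrow> 'w \<Rightarrow> real"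
    and Cv :: "nat list \<Rightarrow> 'w \<Rightarrow> real" and Tv :: "nat list \<Rightarrow> nat \<Rightarrow> 'w \<Rightarrow> real"
  assumes "prob_space M"
    and "C \<in> borel_measurable M" and "\<And>i. T i \<in> borel_measurable M"
    and "\<And>\<omega>. \<omega> \<in> space M \<Longrightarrow> 0 \<le> C \<omega>"
    and "\<And>i \<omega>. \<omega> \<in> space M \<Longrightarrow> 0 \<le> T i \<omega>"
    and "weighted_branching M C T Cv Tv"
    and "measure M {\<omega> \<in> space M. \<forall>i. T i \<omega> \<in> {0, 1}} < 1"
    and "(\<integral>\<^sup>+\<omega>. offspring T \<omega> \<partial>M) > 1"
    and "(\<exists>\<beta>. 0 < \<beta> \<and> \<beta> \<le> 1 \<and> m_fun M T \<beta> < 1 \<and> (\<integral>\<^sup>+\<omega>. ennreal (C \<omega> powr \<beta>) \<partial>M) < \<infinity>)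
      \<or> ((\<exists>\<alpha>. 0 < \<alpha> \<and> \<alpha> < 1/5 \<and> m_fun M T \<alpha> = 1 \<and>
            (\<exists>\<epsilon>>0. \<forall>\<theta>\<in>{-\<epsilon>..\<alpha> + \<epsilon>}. \<theta> \<noteq> \<alpha> \<longrightarrow> 1 < m_fun M T \<theta> \<and> m_fun M T \<theta> < \<infinity>)) \<and>
         (\<integral>\<^sup>+\<omega>. ennreal (C \<omega>) \<partial>M) < \<infinity> \<and>
         (\<exists>\<delta>>0. (\<integral>\<^sup>+\<omega>. ennpowr (offspring T \<omega>) (1 + \<delta>) \<partial>M) < \<infinity>))"
  shows "(AE \<omega> in M. W_star Cv Tv \<omega> < \<infinity>) \<and> fixed_points M C T \<noteq> {}"
proof -
  interpret prob_space M by fact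
  note [measurable] = assms(2,3)
  note C0 = assms(4) and T0 = assms(5)
  define X where "X v \<omega> = (Cv v \<omega>, \<lambda>i. Tv v i \<omega>)" for v \<omega>
  define D where "D = distr M node_space (\<lambda>\<omega>. (C \<omega>, \<lambda>i. T i \<omega>))"
  have root: "Cv [] = C" "Tv [] = T"
    and indep: "indep_vars (\<lambda>_. node_space) X UNIV"
    and law: "distr M node_space (X v) = D" for v
    using assms(6) by (simp_all add: weighted_branching_def X_def[abs_def] D_def)
  interpret iid_tree M X D
    by unfold_locales (rule indep, rule law)
  have CT [measurable]: "(\<lambda>\<omega>. (C \<omega>, \<lambda>i. T i \<omega>)) \<in> M \<rightarrow>\<^sub>M node_space"
    by (intro measurable_Pair measurable_PiM_single') auto
  have integral_D: "(\<integral>\<^sup>+p. h p \<partial>D) = (\<integral>\<^sup>+\<omega>. h (C \<omega>, \<lambda>i. T i \<omega>) \<partial>M)"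
    if "h \<in> borel_measurable node_space" for h
    unfolding D_def using that by (intro nn_integral_distr) auto
  have mom: "mom \<theta> = m_fun M T \<theta>" for \<theta>
  proof -
    have "mom \<theta> = (\<integral>\<^sup>+\<omega>. (\<Sum>i. ennreal (\<bar>T i \<omega>\<bar> powr \<theta>)) \<partial>M)"
      unfolding mom_def by (subst integral_D) auto
    also have "\<dots> = m_fun M T \<theta>"
      unfolding m_fun_def
    proof (intro nn_integral_cong suminf_cong)
      fix \<omega> i assume "\<omega> \<in> space M"
      then show "ennreal (\<bar>T i \<omega>\<bar> powr \<theta>) = (if T i \<omega> > 0 then ennreal (T i \<omega> powr \<theta>) else 0)"
        using T0[of \<omega> i] by auto
    qed
    finally show ?thesis .
  qed
  have moment_C: "(\<integral>\<^sup>+p. ennreal (\<bar>fst p\<bar> powr \<beta>) \<partial>D) = (\<integral>\<^sup>+\<omega>. ennreal (C \<omega> powr \<beta>) \<partial>M)" for \<beta>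
    using C0 by (subst integral_D) (auto intro!: nn_integral_cong)
  have mean_C: "(\<integral>\<^sup>+p. ennreal \<bar>fst p\<bar> \<partial>D) = (\<integral>\<^sup>+\<omega>. ennreal (C \<omega>) \<partial>M)"
    using C0 by (subst integral_D) (auto intro!: nn_integral_cong)
  have nonneg: "AE p in D. 0 \<le> fst p \<and> (\<forall>i. 0 \<le> snd p i)"
    unfolding D_def using C0 T0 by (subst AE_distr_iff) auto
  have "AE \<omega> in M. (\<integral>\<^sup>+v. ennreal \<bar>weight (\<lambda>y. y) v (\<lambda>u. X u \<omega>) * fst (X v \<omega>)\<bar> \<partial>count_space UNIV) < \<infinity>"
    using assms(9)
  proof (elim disjE exE conjE)
    fix \<beta> assume "0 < \<beta>" "\<beta> \<le> 1" "m_fun M T \<beta> < 1" "(\<integral>\<^sup>+\<omega>. ennreal (C \<omega> powr \<beta>) \<partial>M) < \<infinity>"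
    then show ?thesis
      by (intro AE_tree_sum_finite_subcritical) (auto simp: mom moment_C)
  next
    fix \<alpha> \<epsilon>
    assume \<alpha>: "0 < \<alpha>" "\<alpha> < 1 / 5" "m_fun M T \<alpha> = 1" and \<epsilon>: "\<epsilon> > 0"
      and m: "\<forall>\<theta>\<in>{- \<epsilon>..\<alpha> + \<epsilon>}. \<theta> \<noteq> \<alpha> \<longrightarrow> 1 < m_fun M T \<theta> \<and> m_fun M T \<theta> < \<infinity>"
      and C: "(\<integral>\<^sup>+\<omega>. ennreal (C \<omega>) \<partial>M) < \<infinity>"
    \<comment> \<open>The first bound keeps \<open>\<alpha> + \<kappa>\<close> and
      \<open>\<alpha> + 2 * \<kappa>\<close> within the range where the moments are controlled; the
      second, with \<open>\<alpha> < 1/5\<close>, gives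
      \<open>\<alpha> + \<kappa> \<le> 1\<close>.\<close>
    define \<kappa> where "\<kappa> = min (\<epsilon> / 2) (1 / 2)"
    have \<kappa>: "0 < \<kappa>" "2 * \<kappa> \<le> \<epsilon>" "\<alpha> + \<kappa> \<le> 1" using \<epsilon> \<alpha> by (auto simp: \<kappa>_def)
    have "1 < m_fun M T \<theta>" "m_fun M T \<theta> < \<infinity>" if "\<alpha> < \<theta>" "\<theta> \<le> \<alpha> + \<epsilon>" for \<theta>
      using m that \<alpha> \<epsilon> by auto
    then show ?thesis
      using \<alpha> \<kappa> C by (intro AE_tree_sum_finite_critical[of \<alpha> \<kappa>]) (auto simp: mom mean_C)
  qed
  \<comment> \<open>No sign information is required: \<open>ennreal\<close> sends negative terms to
    0, below their absolute values.\<close>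
  moreover have "total_weight (\<lambda>v. X v \<omega>) \<le>
      (\<integral>\<^sup>+v. ennreal \<bar>weight (\<lambda>y. y) v (\<lambda>u. X u \<omega>) * fst (X v \<omega>)\<bar> \<partial>count_space UNIV)" for \<omega>
    unfolding total_weight_def by (intro nn_integral_mono ennreal_leI) auto
  ultimately have fin: "AE \<omega> in M. total_weight (\<lambda>v. X v \<omega>) < \<infinity>"
    by (auto elim!: eventually_mono intro: le_less_trans)
  have "weight (\<lambda>y. y) v (\<lambda>u. X u \<omega>) = branch_weight Tv v \<omega>" for v \<omega>
    by (induction v rule: rev_induct) (auto simp: X_def)
  then have "W_star Cv Tv \<omega> = total_weight (\<lambda>v. X v \<omega>)" for \<omega>
    by (simp add: W_star_def total_weight_def infsum_ennreal_eq_nn_integral_count_space X_def)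
  moreover have "limit_law \<in> fixed_points M C T"
    using limit_law_fixed_point[OF nonneg fin] by (simp add: X_def root)
  ultimately show ?thesis
    using fin by auto
qed

end
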